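(* Let $\mathbb{F}$ be a field, $A\in\mathbb{F}^{n\times n}$, $Z$ a zero forcing set of $A$ with a fixed chronological list of forces $\pi$, and $b\in\mathbb{F}^n$. Let $x'\in\mathbb{F}^n$ with $\operatorname{supp}(x')\subseteq Z$. If $x\in\mathbb{F}^n$ satisfies $Ax=b$ and $x_Z=x'_Z$, then $x=\textsc{Forcing}(A,Z,b-Ax')+x'$.
   Context: Let $G=(V,E)$, $V=[n]$, be the directed graph with $(u,v)\in E$ iff $u\neq v$ and $A_{u,v}\neq0$. Zero forcing: starting from a blue set $Z$, a blue vertex with exactly one non-blue out-neighbour $u$ forces $u$ (colours it blue); $Z$ is a zero forcing set if this eventually colours all of $V$ blue. A chronological list of forces $\pi$ is an ordering $u_1,\dots,u_{n-|Z|}$ of $V\setminus Z$ together with, for each $u_i$, a forcing parent $u_i^{\uparrow}\in Z\cup\{u_1,\dots,u_{i-1}\}$ such that $u_i$ is the only out-neighbour of $u_i^{\uparrow}$ outside $Z\cup\{u_1,\dots,u_{i-1}\}$ (so $A_{u_i^{\uparrow},u_i}\neq0$). The procedure $\textsc{Forcing}(A,Z,c)$ (using $\pi$): set $x\gets0$; for each $u\in V\setminus Z$ in the order $\pi$, set $x_u\gets (c_{u^{\uparrow}}-A_{u^{\uparrow},*}x)/A_{u^{\uparrow},u}$, where $A_{w,*}$ is row $w$ of $A$; return $x$. $\operatorname{supp}(x')$ is the set of non-zero coordinates of $x'$, and $x_Z$ is the restriction of $x$ to $Z$. *)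

theory Defs
  imports "Jordan_Normal_Form.Matrix"
begin

text \<open>
  Matrices and vectors are zero-based, so the vertex set of the digraph of an
  \<open>n \<times> n\<close> matrix is \<open>{..<n}\<close> rather than \<open>{1..n}\<close>. The digraph is given by its arc relation;
  the out-neighbourhood of \<open>w\<close> is the relational image \<open>E `` {w}\<close>.
\<close>

definition mat_verts :: "'a mat \<Rightarrow> nat set" where
  "mat_verts A = {..<dim_row A}"

definition mat_arcs :: "'a :: zero mat \<Rightarrow> nat rel" where
  "mat_arcs A = {(u, v). u \<in> mat_verts A \<and> v \<in> mat_verts A \<and> u \<noteq> v \<and> A $$ (u, v) \<noteq> 0}"

definition forces :: "'v rel \<Rightarrow> 'v set \<Rightarrow> 'v \<Rightarrow> 'v \<Rightarrow> bool" where
  "forces E B w u \<longleftrightarrow> w \<in> B \<and> E `` {w} - B = {u}"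

definition forcing_step_rel :: "'v rel \<Rightarrow> 'v set rel" where
  "forcing_step_rel E = {(B, insert u B) | B u. \<exists>w. forces E B w u}"

definition zero_forcing_set :: "'a :: zero mat \<Rightarrow> nat set \<Rightarrow> bool" where
  "zero_forcing_set A Z \<longleftrightarrow>
     Z \<subseteq> mat_verts A \<and> (Z, mat_verts A) \<in> (forcing_step_rel (mat_arcs A))\<^sup>*"

text \<open>
  A chronological list of forces consists of pairs (forced vertex, forcing parent).
\<close>

definition chronological_forces :: "'a :: zero mat \<Rightarrow> nat set \<Rightarrow> (nat \<times> nat) list \<Rightarrow> bool" where
  "chronological_forces A Z \<pi> \<longleftrightarrow>
     distinct (map fst \<pi>) \<and> set (map fst \<pi>) = mat_verts A - Z \<and>
     (\<forall>i<length \<pi>. forces (mat_arcs A) (Z \<union> set (map fst (take i \<pi>))) (snd (\<pi> ! i)) (fst (\<pi> ! i)))"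

text \<open>
  The set \<open>Z\<close> is not an argument of the procedure: the loop ranges over the complement of \<open>Z\<close>
  in the order of \<open>\<pi>\<close>, and a chronological list of forces for \<open>Z\<close> enumerates exactly this complement.
\<close>

definition forcing :: "'a :: field mat \<Rightarrow> (nat \<times> nat) list \<Rightarrow> 'a vec \<Rightarrow> 'a vec" where
  "forcing A \<pi> c =
     fold (\<lambda>(u, w) x. x |\<^sub>v u \<mapsto> ((c $ w - row A w \<bullet> x) / A $$ (w, u))) \<pi> (0\<^sub>v (dim_col A))"

definition vec_supp :: "'a :: zero vec \<Rightarrow> nat set" where
  "vec_supp x = {i. i < dim_vec x \<and> x $ i \<noteq> 0}"

end

theory Submission
  imports Defs
begin

text \<open>
  Put \<open>y = x - x'\<close>, so that \<open>A y = b - A x'\<close> and \<open>y\<close> vanishes on \<open>Z\<close>. The loop invariant is that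
  the current vector agrees with \<open>y\<close> on the blue vertices and vanishes elsewhere: when \<open>w\<close> forces
  \<open>u\<close>, row \<open>w\<close> of \<open>A\<close> vanishes at every other white vertex, so equation \<open>w\<close> of the system determines
  \<open>y\<^sub>u\<close> from the blue coordinates of \<open>y\<close>.
\<close>

text \<open>The restriction keeps the full dimension and is padded with zeros, so that it can itself
  be a state of the loop, which starts from the zero vector.\<close>

definition restrict_vec :: "nat set \<Rightarrow> 'a :: zero vec \<Rightarrow> 'a vec" where
  "restrict_vec B y = vec (dim_vec y) (\<lambda>i. if i \<in> B then y $ i else 0)"

lemma forces_row_scalar_prod:
  fixes A :: "'a :: field mat"
  assumes A: "A \<in> carrier_mat n n" and y: "y \<in> carrier_vec n"
    and f: "forces (mat_arcs A) B w u"
  shows "row A w \<bullet> y = row A w \<bullet> restrict_vec B y + A $$ (w, u) * y $ u"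
proof -
  have wB: "w \<in> B" and out: "mat_arcs A `` {w} - B = {u}"
    using f by (auto simp: forces_def)
  then have "(w, u) \<in> mat_arcs A" and uB: "u \<notin> B" by auto
  then have w: "w < n" and u: "u < n"
    using A by (auto simp: mat_arcs_def mat_verts_def)
  \<comment> \<open>\<open>mat_arcs\<close> has no loops and says nothing about the diagonal entry
    \<open>A $$ (w, w)\<close>; the case \<open>v = w\<close> cannot occur because \<open>w\<close>
    is blue.\<close>
  have zero: "A $$ (w, v) = 0" if "v < n" "v \<notin> B" "v \<noteq> u" for v
    using that wB out w A by (fastforce simp: mat_arcs_def mat_verts_def)
  have "row A w \<bullet> y = (\<Sum>i<n. A $$ (w, i) * y $ i)"
    using A y w by (auto simp: scalar_prod_def atLeast0LessThan intro!: sum.cong)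
  also have "\<dots> = (\<Sum>i<n. A $$ (w, i) * restrict_vec B y $ i
      + (if i = u then A $$ (w, u) * y $ u else 0))"
    using y uB zero by (intro sum.cong) (auto simp: restrict_vec_def)
  also have "\<dots> = (\<Sum>i<n. A $$ (w, i) * restrict_vec B y $ i) + A $$ (w, u) * y $ u"
    using u by (simp add: sum.distrib)
  also have "(\<Sum>i<n. A $$ (w, i) * restrict_vec B y $ i) = row A w \<bullet> restrict_vec B y"
    using A y w by (auto simp: scalar_prod_def atLeast0LessThan restrict_vec_def intro!: sum.cong)
  finally show ?thesis .
qed

lemma forcing_step:
  fixes A :: "'a :: field mat"
  assumes A: "A \<in> carrier_mat n n" and y: "y \<in> carrier_vec n"
    and f: "forces (mat_arcs A) B w u"
  shows "restrict_vec B y |\<^sub>v u \<mapsto> (((A *\<^sub>v y) $ w - row A w \<bullet> restrict_vec B y) / A $$ (w, u))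
    = restrict_vec (insert u B) y"
proof -
  have "(w, u) \<in> mat_arcs A" using f by (auto simp: forces_def)
  then have w: "w < n" and nz: "A $$ (w, u) \<noteq> 0"
    using A by (auto simp: mat_arcs_def mat_verts_def)
  have "((A *\<^sub>v y) $ w - row A w \<bullet> restrict_vec B y) / A $$ (w, u) = y $ u"
    using forces_row_scalar_prod[OF A y f] w nz A by simp
  then show ?thesis
    by (intro eq_vecI) (auto simp: restrict_vec_def update_vec_def)
qed

text \<open>The case \<open>x' = 0\<close> of the theorem; linearity reduces the general case to
  it.\<close>

lemma forcing_mult_mat_vec:
  fixes A :: "'a :: field mat"
  assumes A: "A \<in> carrier_mat n n" and y: "y \<in> carrier_vec n"
    and \<pi>: "chronological_forces A Z \<pi>" and Z: "\<And>i. i \<in> Z \<Longrightarrow> i < n \<Longrightarrow> y $ i = 0"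
  shows "forcing A \<pi> (A *\<^sub>v y) = y"
proof -
  \<comment> \<open>A proper prefix of \<open>\<pi>\<close> does not exhaust the complement of
    \<open>Z\<close>, so it is not a chronological list for \<open>Z\<close>; hence the induction
    runs over the prefix length with \<open>\<pi>\<close> fixed.\<close>
  have inv: "forcing A (take k \<pi>) (A *\<^sub>v y) = restrict_vec (Z \<union> set (map fst (take k \<pi>))) y"
    if "k \<le> length \<pi>" for k
    using that
  proof (induction k)
    case 0
    \<comment> \<open>Before any force, both sides are the zero vector, since \<open>y\<close>
      vanishes on \<open>Z\<close>.\<close>
    show ?case
      using A y Z by (intro eq_vecI) (auto simp: forcing_def restrict_vec_def)
  next
    case (Suc k)
    let ?B = "Z \<union> set (map fst (take k \<pi>))"
    obtain u w where uw: "\<pi> ! k = (u, w)" by force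
    have take: "take (Suc k) \<pi> = take k \<pi> @ [(u, w)]"
      using Suc.prems uw by (simp add: take_Suc_conv_app_nth)
    have "forces (mat_arcs A) ?B w u"
      using \<pi> Suc.prems uw unfolding chronological_forces_def
      by (metis Suc_le_eq fst_conv snd_conv)
    from forcing_step[OF A y this] Suc show ?case
      by (simp add: forcing_def take)
  qed
  have "set (map fst \<pi>) = {..<n} - Z"
    using \<pi> A by (auto simp: chronological_forces_def mat_verts_def)
  then have "restrict_vec (Z \<union> set (map fst \<pi>)) y = y"
    using y by (intro eq_vecI) (auto simp: restrict_vec_def)
  with inv[of "length \<pi>"] show ?thesis by simp
qed

theorem theorem2:
  fixes A :: "'a :: field mat" and b x x' :: "'a vec" and n :: nat
    and Z :: "nat set" and \<pi> :: "(nat \<times> nat) list"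
  assumes "A \<in> carrier_mat n n"
    and "zero_forcing_set A Z"
    and "chronological_forces A Z \<pi>"
    and "b \<in> carrier_vec n"
    and "x' \<in> carrier_vec n"
    and "vec_supp x' \<subseteq> Z"
    and "x \<in> carrier_vec n"
    and "A *\<^sub>v x = b"
    and "\<forall>i\<in>Z. x $ i = x' $ i"
  shows "x = forcing A \<pi> (b - A *\<^sub>v x') + x'"
proof -
  have "b - A *\<^sub>v x' = A *\<^sub>v (x - x')"
    using assms by (simp add: mult_minus_distrib_mat_vec)
  moreover have "forcing A \<pi> (A *\<^sub>v (x - x')) = x - x'"
    using assms by (intro forcing_mult_mat_vec[of _ n _ Z]) auto
  ultimately show ?thesis
    using assms by (intro eq_vecI) auto
qed

end
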